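(* Let $X$ be a regular topological space such that every point of $X$ is a $G_\delta$ (i.e. for every $x\in X$ the singleton $\{x\}$ is an intersection of countably many open subsets of $X$). Suppose that Bob has a winning strategy in the game $\mathsf{G}_{\mathrm{fin}}^{\omega_1}(\mathrm{O},\mathrm{O})$ played on $X$. Then $|X|\le 2^{\omega}$.
   Context: Convention (Engelking): regular spaces are $T_1$. $\mathrm{O}$ denotes the family of all open covers of $X$. The game $\mathsf{G}_{\mathrm{fin}}^{\omega_1}(\mathrm{O},\mathrm{O})$ (long Menger game) is played on $X$ by Alice and Bob with innings indexed by the ordinals $\xi<\omega_1$. At inning $\xi$ Alice chooses an open cover $\mathcal{C}_\xi\in\mathrm{O}$, and then Bob chooses a finite subset $\mathcal{F}_\xi\subset\mathcal{C}_\xi$. Bob wins the play if $\bigcup_{\xi<\omega_1}\mathcal{F}_\xi$ covers $X$; otherwise Alice wins. A strategy for Bob is a function $\sigma$ assigning to each sequence $s=\langle \mathcal{C}_\beta:\beta\le\alpha\rangle$ of open covers with $\alpha<\omega_1$ (the moves of Alice up to and including inning $\alpha$) a finite set $\sigma(s)\subset \mathcal{C}_\alpha$. It is winning if Bob wins every play in which his move at each inning $\alpha<\omega_1$ is $\sigma(\langle\mathcal{C}_\beta:\beta\le\alpha\rangle)$. *)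

theory Defs
  imports "HOL-Analysis.Analysis"
begin

unbundle cardinal_syntax

text \<open>
  The ordinal \<open>\<omega>\<^sub>1\<close> is represented by the library's canonical well-order
  whose order type is the least uncountable cardinal; the innings are the elements of its field.
\<close>

definition omega1 :: "nat set rel" where
  "omega1 = cardSuc natLeq"

definition open_covers :: "'a topology \<Rightarrow> 'a set set set" where
  "open_covers X = {\<C>. (\<forall>U\<in>\<C>. openin X U) \<and> \<Union>\<C> = topspace X}"

definition menger_play ::
    "'a topology \<Rightarrow> (nat set \<Rightarrow> 'a set set) \<Rightarrow> (nat set \<Rightarrow> 'a set set) \<Rightarrow> bool" where
  "menger_play X \<C> \<F> \<longleftrightarrow>
     (\<forall>\<xi>\<in>Field omega1. \<C> \<xi> \<in> open_covers X \<and> finite (\<F> \<xi>) \<and> \<F> \<xi> \<subseteq> \<C> \<xi>)"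

definition bob_wins :: "'a topology \<Rightarrow> (nat set \<Rightarrow> 'a set set) \<Rightarrow> bool" where
  "bob_wins X \<F> \<longleftrightarrow> \<Union>(\<Union>\<xi>\<in>Field omega1. \<F> \<xi>) = topspace X"

text \<open>
  A sequence \<open>\<langle>\<C>\<^sub>\<beta> : \<beta> \<le> \<alpha>\<rangle>\<close> is a partial function with domain
  \<open>under omega1 \<alpha> = {\<beta>. \<beta> \<le> \<alpha>}\<close>, so that its length is determined by the sequence itself.
  The values of a strategy on other arguments are irrelevant.
\<close>

definition bob_strategy ::
    "'a topology \<Rightarrow> ((nat set \<rightharpoonup> 'a set set) \<Rightarrow> 'a set set) \<Rightarrow> bool" where
  "bob_strategy X \<sigma> \<longleftrightarrow>
     (\<forall>\<alpha>\<in>Field omega1. \<forall>s. dom s = under omega1 \<alpha> \<and> ran s \<subseteq> open_covers X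
        \<longrightarrow> finite (\<sigma> s) \<and> \<sigma> s \<subseteq> the (s \<alpha>))"

definition bob_winning_strategy ::
    "'a topology \<Rightarrow> ((nat set \<rightharpoonup> 'a set set) \<Rightarrow> 'a set set) \<Rightarrow> bool" where
  "bob_winning_strategy X \<sigma> \<longleftrightarrow>
     bob_strategy X \<sigma> \<and>
     (\<forall>\<C> \<F>. menger_play X \<C> \<F> \<and>
            (\<forall>\<alpha>\<in>Field omega1. \<F> \<alpha> = \<sigma> ((\<lambda>\<beta>. Some (\<C> \<beta>)) |` under omega1 \<alpha>))
        \<longrightarrow> bob_wins X \<F>)"

end

theory Submission
  imports Defs
begin

text \<open>
  Fix a winning strategy \<open>\<sigma>\<close> for Bob. After a countable history \<open>s\<close> of Alice's moves, let
  \<open>K\<close> be the set of points lying in the closure of \<open>\<Union>(\<sigma> (s, \<C>))\<close> for every open cover \<open>\<C>\<close>.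
  By regularity \<open>K\<close> is compact, so \<open>|K| \<le> 2\<^sup>\<omega>\<close>, and \<open>K\<close> is an intersection of at most
  \<open>2\<^sup>\<omega>\<close> open sets. Since every open cover of the space has a subcover of size at most
  \<open>\<omega>\<^sub>1\<close> (let Alice repeat the same cover forever), \<open>2\<^sup>\<omega>\<close> many covers \<open>\<C>\<close> already suffice
  to cut out a set of size at most \<open>2\<^sup>\<omega>\<close>. Closing off yields a family \<open>M\<close> of \<open>2\<^sup>\<omega>\<close>
  covers that contains these covers for every history from \<open>M\<close>. A point outside all the sets
  cut out for histories from \<open>M\<close> would let Alice, playing covers from \<open>M\<close> only, keep it
  uncovered in all \<open>\<omega>\<^sub>1\<close> innings; and there are only \<open>2\<^sup>\<omega>\<close> such histories.
\<close>

section \<open>Cardinal arithmetic up to the continuum\<close>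

lemma Cinfinite_continuum: "Cinfinite (ctwo ^c natLeq)"
  by (intro Cinfinite_cexp natLeq_Cinfinite ordLeq_refl Card_order_ctwo)

lemma card_of_subset_continuum:
  "A \<subseteq> B \<Longrightarrow> |B| \<le>o ctwo ^c natLeq \<Longrightarrow> |A| \<le>o ctwo ^c natLeq"
  by (rule ordLeq_transitive[OF card_of_mono1])

lemma card_of_image_continuum:
  "|A| \<le>o ctwo ^c natLeq \<Longrightarrow> |f ` A| \<le>o ctwo ^c natLeq"
  by (rule ordLeq_transitive[OF card_of_image])

lemma card_of_UNION_continuum:
  assumes "|I| \<le>o ctwo ^c natLeq" and "\<And>i. i \<in> I \<Longrightarrow> |A i| \<le>o ctwo ^c natLeq"
  shows "|\<Union>i\<in>I. A i| \<le>o ctwo ^c natLeq"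
  using card_of_UNION_ordLeq_infinite_Field assms Cinfinite_continuum
  by (metis cinfinite_def)

lemma card_of_Un_continuum:
  assumes "|A| \<le>o ctwo ^c natLeq" and "|B| \<le>o ctwo ^c natLeq"
  shows "|A \<union> B| \<le>o ctwo ^c natLeq"
  using card_of_Un_ordLeq_infinite_Field assms Cinfinite_continuum
  by (metis cinfinite_def)

lemma card_of_Times_continuum:
  assumes "|A| \<le>o ctwo ^c natLeq" and "|B| \<le>o ctwo ^c natLeq"
  shows "|A \<times> B| \<le>o ctwo ^c natLeq"
  using card_of_Times_ordLeq_infinite_Field assms Cinfinite_continuum
  by (metis cinfinite_def)

lemma natLeq_ordLess_continuum: "natLeq <o ctwo ^c natLeq"
  by (intro ordLess_ctwo_cexp natLeq_Card_order)

lemma omega1_ordLeq_continuum: "|Field omega1| \<le>o ctwo ^c natLeq"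
proof -
  have "omega1 \<le>o ctwo ^c natLeq"
    unfolding omega1_def
    by (intro cardSuc_least natLeq_Card_order Card_order_cexp natLeq_ordLess_continuum)
  moreover have "Card_order omega1"
    unfolding omega1_def by (intro cardSuc_Card_order natLeq_Card_order)
  ultimately show ?thesis
    using card_of_Field_ordIso ordIso_ordLeq_trans by blast
qed

lemma countable_iff_ordLeq_natLeq: "countable A \<longleftrightarrow> |A| \<le>o natLeq"
proof -
  have "countable A \<longleftrightarrow> |A| \<le>o |UNIV :: nat set|"
    by (simp add: countable_def flip: card_of_ordLeq)
  then show ?thesis
    using card_of_nat ordIso_iff_ordLeq ordLeq_transitive by metis
qed

lemma countable_ordLeq_continuum: "countable A \<Longrightarrow> |A| \<le>o ctwo ^c natLeq"
  using countable_iff_ordLeq_natLeq natLeq_ordLess_continuum ordLeq_ordLess_trans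
    ordLess_imp_ordLeq by blast

text \<open>Rests on (2^omega)^omega = 2^(omega * omega) = 2^omega. Countable histories of Alice's
  moves will be coded by such sequences, which keeps their number at most the continuum.\<close>

lemma card_of_sequences_continuum:
  assumes "|A| \<le>o ctwo ^c natLeq"
  shows "|{g :: nat \<Rightarrow> 'a. range g \<subseteq> A}| \<le>o ctwo ^c natLeq"
proof -
  have "{g :: nat \<Rightarrow> 'a. range g \<subseteq> A} = Func (UNIV :: nat set) A"
    by (auto simp: Func_def)
  also have "|Func (UNIV :: nat set) A| =o |A| ^c natLeq"
    unfolding cexp_def by (simp add: Field_natLeq Field_card_of card_of_refl)
  finally have "|{g :: nat \<Rightarrow> 'a. range g \<subseteq> A}| =o |A| ^c natLeq" .
  also have "|A| ^c natLeq \<le>o (ctwo ^c natLeq) ^c natLeq"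
    by (rule cexp_mono1[OF assms natLeq_Card_order])
  also have "(ctwo ^c natLeq) ^c natLeq =o ctwo ^c (natLeq *c natLeq)"
    by (rule cexp_cprod[OF Card_order_ctwo])
  also have "ctwo ^c (natLeq *c natLeq) =o ctwo ^c natLeq"
    by (intro cexp_cong2 cprod_infinite natLeq_Cinfinite Card_order_ctwo natLeq_Card_order Card_order_cprod)
  finally show ?thesis .
qed

lemma card_of_Fpow_continuum:
  assumes "|A| \<le>o ctwo ^c natLeq"
  shows "|Fpow A| \<le>o ctwo ^c natLeq"
proof -
  \<comment> \<open>A nonempty finite set is the range of a repeating enumeration of itself; the
    empty set has none and is added separately.\<close>
  have "Fpow A \<subseteq> {{}} \<union> range ` {g :: nat \<Rightarrow> 'a. range g \<subseteq> A}"
  proof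
    fix T assume T: "T \<in> Fpow A"
    show "T \<in> {{}} \<union> range ` {g :: nat \<Rightarrow> 'a. range g \<subseteq> A}"
    proof (cases "T = {}")
      case False
      then have "T = range (from_nat_into T)"
        using T by (simp add: Fpow_def countable_finite)
      moreover have "T \<subseteq> A"
        using T by (simp add: Fpow_def)
      ultimately show ?thesis
        by auto
    qed simp
  qed
  moreover have "|{{}} \<union> range ` {g :: nat \<Rightarrow> 'a. range g \<subseteq> A}| \<le>o ctwo ^c natLeq"
  proof (rule card_of_Un_continuum)
    show "|{{} :: 'a set}| \<le>o ctwo ^c natLeq"
      by (simp add: countable_ordLeq_continuum)
    show "|range ` {g :: nat \<Rightarrow> 'a. range g \<subseteq> A}| \<le>o ctwo ^c natLeq"
      by (intro card_of_image_continuum card_of_sequences_continuum assms)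
  qed
  ultimately show ?thesis
    by (rule card_of_subset_continuum)
qed

section \<open>The ordinal \<open>omega1\<close> and closing off under countable operations\<close>

lemma wf_omega1: "wf (omega1 - Id)"
  unfolding omega1_def
  using cardSuc_Card_order[OF natLeq_Card_order] card_order_on_well_order_on
    well_order_on_def by blast

lemma under_omega1:
  assumes "\<alpha> \<in> Field omega1"
  shows "under omega1 \<alpha> = insert \<alpha> (underS omega1 \<alpha>)"
proof -
  have "Refl omega1"
    using cardSuc_Card_order[OF natLeq_Card_order]
    unfolding omega1_def card_order_on_def well_order_on_def linear_order_on_def
      partial_order_on_def preorder_on_def by blast
  then show ?thesis
    using Refl_under_underS assms by fastforce
qed

lemma countable_underS_omega1:
  assumes "\<alpha> \<in> Field omega1"
  shows "countable (underS omega1 \<alpha>)"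
proof -
  have "|underS omega1 \<alpha>| <o cardSuc natLeq"
    using card_of_underS[of omega1 \<alpha>] assms cardSuc_Card_order[OF natLeq_Card_order]
    unfolding omega1_def by blast
  then show ?thesis
    using cardSuc_ordLeq_ordLess[OF natLeq_Card_order card_of_Card_order]
    unfolding countable_iff_ordLeq_natLeq by blast
qed

text \<open>\<open>M\<close> is the union of an increasing chain of length \<open>omega1\<close>;
  each stage adds the values of \<open>F\<close> at all sequences from the union of the earlier
  stages. Each stage has only countably many predecessors, hence stays within the continuum. A
  sequence in \<open>M\<close> already lies in a single stage, and any later stage contains its
  value.\<close>

lemma closing_off:
  fixes F :: "(nat \<Rightarrow> 'b) \<Rightarrow> 'b set"
  assumes A0: "|A0| \<le>o ctwo ^c natLeq" "A0 \<subseteq> S"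
    and F: "\<And>g. range g \<subseteq> S \<Longrightarrow> |F g| \<le>o ctwo ^c natLeq \<and> F g \<subseteq> S"
  obtains M where "A0 \<subseteq> M" "M \<subseteq> S" "|M| \<le>o ctwo ^c natLeq"
    "\<And>g. range g \<subseteq> M \<Longrightarrow> F g \<subseteq> M"
proof -
  define step where "step B = A0 \<union> B \<union> (\<Union>g\<in>{g. range g \<subseteq> B}. F g)" for B
  define L where "L = wfrec (omega1 - Id) (\<lambda>L \<alpha>. step (\<Union>\<beta>\<in>underS omega1 \<alpha>. L \<beta>))"
  have L: "L \<alpha> = step (\<Union>\<beta>\<in>underS omega1 \<alpha>. L \<beta>)" for \<alpha>
  proof -
    \<comment> \<open>The recursion consults \<open>L\<close> only strictly below
      \<open>\<alpha>\<close>, where \<open>cut\<close> changes nothing.\<close>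
    have "(\<Union>\<beta>\<in>underS omega1 \<alpha>. cut L (omega1 - Id) \<alpha> \<beta>) = (\<Union>\<beta>\<in>underS omega1 \<alpha>. L \<beta>)"
      by (rule SUP_cong) (auto simp: underS_def cut_def)
    then show ?thesis
      unfolding L_def by (subst wfrec[OF wf_omega1]) simp
  qed
  have step: "|step B| \<le>o ctwo ^c natLeq \<and> step B \<subseteq> S"
    if "|B| \<le>o ctwo ^c natLeq" "B \<subseteq> S" for B
  proof
    show "|step B| \<le>o ctwo ^c natLeq"
      unfolding step_def
      using that F A0 by (intro card_of_Un_continuum card_of_UNION_continuum card_of_sequences_continuum) auto
    show "step B \<subseteq> S"
      using that F A0 unfolding step_def by blast
  qed
  have bound: "\<alpha> \<in> Field omega1 \<longrightarrow> |L \<alpha>| \<le>o ctwo ^c natLeq \<and> L \<alpha> \<subseteq> S" for \<alpha>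
  proof (induction \<alpha> rule: wf_induct_rule[OF wf_omega1])
    case (1 \<alpha>)
    show ?case
    proof
      assume \<alpha>: "\<alpha> \<in> Field omega1"
      have IH: "|L \<beta>| \<le>o ctwo ^c natLeq \<and> L \<beta> \<subseteq> S" if "\<beta> \<in> underS omega1 \<alpha>" for \<beta>
        using 1 that by (auto simp: underS_def Field_def)
      show "|L \<alpha>| \<le>o ctwo ^c natLeq \<and> L \<alpha> \<subseteq> S"
        unfolding L[of \<alpha>]
        by (intro step card_of_UNION_continuum UN_least
            countable_ordLeq_continuum[OF countable_underS_omega1[OF \<alpha>]]) (use IH in auto)
    qed
  qed
  have chain: "L \<beta> \<subseteq> L \<alpha>" if "(\<beta>, \<alpha>) \<in> omega1" for \<alpha> \<beta>
    using that L[of \<alpha>] by (cases "\<alpha> = \<beta>") (auto simp: step_def underS_def)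
  then have relChain: "relChain (cardSuc natLeq) L"
    by (simp add: relChain_def omega1_def)
  define M where "M = (\<Union>\<alpha>\<in>Field omega1. L \<alpha>)"
  have inf: "Cinfinite omega1"
    unfolding omega1_def by (rule Cinfinite_cardSuc[OF natLeq_Cinfinite])
  have ne: "Field omega1 \<noteq> {}"
    using inf by (auto simp: cinfinite_def)
  show thesis
  proof
    show "A0 \<subseteq> M"
    proof -
      obtain \<alpha> where "\<alpha> \<in> Field omega1"
        using ne by blast
      moreover have "A0 \<subseteq> L \<alpha>"
        unfolding L[of \<alpha>] step_def by blast
      ultimately show ?thesis
        by (auto simp: M_def)
    qed
    show "M \<subseteq> S"
      using bound by (auto simp: M_def)
    show "|M| \<le>o ctwo ^c natLeq"
      unfolding M_def using bound by (intro card_of_UNION_continuum omega1_ordLeq_continuum) auto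
    fix g :: "nat \<Rightarrow> 'b" assume g: "range g \<subseteq> M"
    have "|range g| \<le>o natLeq"
      by (simp flip: countable_iff_ordLeq_natLeq)
    \<comment> \<open>Regularity of the successor cardinal: a countable subset of the union of the
      chain is absorbed by one stage.\<close>
    then obtain \<beta> where \<beta>: "\<beta> \<in> Field omega1" "range g \<subseteq> L \<beta>"
      using cardSuc_UNION_Cinfinite[OF natLeq_Cinfinite relChain] g
      unfolding M_def omega1_def by blast
    \<comment> \<open>\<open>omega1\<close> has no last element, so some later stage adds
      \<open>F g\<close>.\<close>
    obtain \<alpha> where \<alpha>: "\<alpha> \<in> Field omega1" "\<beta> \<in> underS omega1 \<alpha>"
      using infinite_Card_order_limit[of omega1 \<beta>] inf \<beta>(1)
      by (auto simp: underS_def cinfinite_def)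
    have "F g \<subseteq> L \<alpha>"
      using \<alpha>(2) \<beta>(2) unfolding L[of \<alpha>] step_def by blast
    then show "F g \<subseteq> M"
      using \<alpha>(1) by (auto simp: M_def)
  qed
qed


section \<open>Regular spaces whose points are G_delta sets\<close>

lemma regular_space_shrink:
  assumes "regular_space X" "openin X W" "x \<in> W"
  obtains U where "openin X U" "x \<in> U" "X closure_of U \<subseteq> W"
proof -
  obtain U C where "openin X U" "closedin X C" "x \<in> U" "U \<subseteq> C" "C \<subseteq> W"
    using assms unfolding neighbourhood_base_of_closedin[symmetric] neighbourhood_base_of by metis
  then show thesis
    using that closure_of_minimal by (metis subset_trans)
qed

text \<open>Each set is chosen with its closure inside both the previous one and the next set of a
  G_delta representation. The closure condition is what later forces cluster points of a sequence
  taken from the sets \<open>V n\<close> to equal \<open>x\<close>.\<close>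

lemma shrinking_neighbourhoods:
  assumes reg: "regular_space X" and "gdelta_in X {x}"
  obtains V :: "nat \<Rightarrow> 'a set" where
    "\<And>n. openin X (V n)" "\<And>n. X closure_of V (Suc n) \<subseteq> V n" "(\<Inter>n. V n) = {x}"
proof -
  obtain G :: "nat \<Rightarrow> 'a set" where G: "\<And>n. openin X (G n)" "(\<Inter>n. G n) = {x}"
    using assms(2) unfolding gdelta_in_descending by auto
  have "\<exists>V. \<forall>n. (openin X (V n) \<and> x \<in> V n \<and> V n \<subseteq> G n) \<and> X closure_of V (Suc n) \<subseteq> V n"
  proof (rule dependent_nat_choice)
    show "\<exists>U. openin X U \<and> x \<in> U \<and> U \<subseteq> G 0"
      using G by blast
    fix U n assume U: "openin X U \<and> x \<in> U \<and> U \<subseteq> G n"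
    have "openin X (U \<inter> G (Suc n))" "x \<in> U \<inter> G (Suc n)"
      using U G by blast+
    then obtain U' where U': "openin X U'" "x \<in> U'" "X closure_of U' \<subseteq> U \<inter> G (Suc n)"
      using regular_space_shrink[OF reg] by metis
    then have "U' \<subseteq> X closure_of U'"
      by (simp add: closure_of_subset openin_subset)
    then show "\<exists>U'. (openin X U' \<and> x \<in> U' \<and> U' \<subseteq> G (Suc n)) \<and> X closure_of U' \<subseteq> U"
      using U' by blast
  qed
  then obtain V where V: "\<And>n. openin X (V n) \<and> x \<in> V n \<and> V n \<subseteq> G n"
      "\<And>n. X closure_of V (Suc n) \<subseteq> V n"
    by metis
  moreover have "(\<Inter>n. V n) = {x}"
  proof
    have "(\<Inter>n. V n) \<subseteq> (\<Inter>n. G n)"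
      by (intro INF_mono) (use V(1) in blast)
    then show "(\<Inter>n. V n) \<subseteq> {x}"
      by (simp add: G(2))
  qed (use V(1) in auto)
  ultimately show thesis
    using that by blast
qed

lemma shrinking_neighbourhood_system:
  assumes "regular_space X" and "\<And>x. x \<in> topspace X \<Longrightarrow> gdelta_in X {x}"
  obtains V :: "'a \<Rightarrow> nat \<Rightarrow> 'a set" where
    "\<And>x n. x \<in> topspace X \<Longrightarrow> openin X (V x n)"
    "\<And>x n. x \<in> topspace X \<Longrightarrow> X closure_of V x (Suc n) \<subseteq> V x n"
    "\<And>x. x \<in> topspace X \<Longrightarrow> (\<Inter>n. V x n) = {x}"
proof -
  have "\<exists>V. (\<forall>n. openin X (V n)) \<and> (\<forall>n. X closure_of V (Suc n) \<subseteq> V n) \<and> (\<Inter>n::nat. V n) = {x}"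
    if "x \<in> topspace X" for x
    using shrinking_neighbourhoods[OF assms(1) assms(2)[OF that]] by metis
  then show thesis
    using that by metis
qed

text \<open>Every point of \<open>K\<close> has some \<open>V x n\<close> that misses
  \<open>p\<close>, and compactness leaves finitely many of them. The witness is a finite set of
  indices rather than an open set, so that all possible witnesses can be counted through
  \<open>|K|\<close>.\<close>

lemma compactin_neighbourhood_avoiding:
  assumes K: "compactin X K" and "p \<notin> K"
    and V: "\<And>x n. x \<in> topspace X \<Longrightarrow> openin X (V x n)"
      "\<And>x. x \<in> topspace X \<Longrightarrow> (\<Inter>n::nat. V x n) = {x}"
  obtains T where "T \<in> Fpow (K \<times> UNIV)" "K \<subseteq> (\<Union>(x, n)\<in>T. V x n)" "p \<notin> (\<Union>(x, n)\<in>T. V x n)"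
proof -
  have KX: "x \<in> topspace X" if "x \<in> K" for x
    using K that by (auto simp: compactin_def)
  have "\<exists>n. p \<notin> V x n" if "x \<in> K" for x
  proof -
    have "p \<notin> (\<Inter>n. V x n)"
      using V(2)[OF KX[OF that]] that \<open>p \<notin> K\<close> by auto
    then show ?thesis
      by blast
  qed
  then obtain k where k: "\<And>x. x \<in> K \<Longrightarrow> p \<notin> V x (k x)"
    by metis
  have "\<forall>U\<in>(\<lambda>x. V x (k x)) ` K. openin X U"
    using V(1) KX by auto
  moreover have "K \<subseteq> \<Union>((\<lambda>x. V x (k x)) ` K)"
  proof
    fix x assume "x \<in> K"
    then have "x \<in> V x (k x)"
      using V(2)[OF KX] by blast
    then show "x \<in> \<Union>((\<lambda>x. V x (k x)) ` K)"
      using \<open>x \<in> K\<close> by blast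
  qed
  ultimately obtain \<G> where \<G>: "finite \<G>" "\<G> \<subseteq> (\<lambda>x. V x (k x)) ` K" "K \<subseteq> \<Union>\<G>"
    using K unfolding compactin_def by meson
  then obtain D where D: "D \<subseteq> K" "finite D" "K \<subseteq> (\<Union>x\<in>D. V x (k x))"
    using finite_subset_image[OF \<G>(1,2)] by blast
  define T where "T = (\<lambda>x. (x, k x)) ` D"
  have "(\<Union>(x, n)\<in>T. V x n) = (\<Union>x\<in>D. V x (k x))"
    by (auto simp: T_def)
  moreover have "T \<in> Fpow (K \<times> UNIV)"
    using D by (auto simp: T_def Fpow_def)
  ultimately show thesis
    using that[of T] D k by auto
qed

text \<open>
  Closing off under limits of sequences makes \<open>M\<close> closed, hence compact; closing off under a choice
  of points outside finite unions of basic neighbourhoods then makes it exhaust the space.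
\<close>

lemma compact_gdelta_points_ordLeq_continuum:
  assumes compact: "compact_space X" and reg: "regular_space X"
    and gdelta: "\<And>x. x \<in> topspace X \<Longrightarrow> gdelta_in X {x}"
  shows "|topspace X| \<le>o ctwo ^c natLeq"
proof (cases "topspace X = {}")
  case True
  then show ?thesis
    by (simp add: countable_ordLeq_continuum)
next
  case False
  then obtain x0 where x0: "x0 \<in> topspace X"
    by blast
  obtain V where V: "\<And>x n. x \<in> topspace X \<Longrightarrow> openin X (V x n)"
    "\<And>x n. x \<in> topspace X \<Longrightarrow> X closure_of V x (Suc n) \<subseteq> V x n"
    "\<And>x. x \<in> topspace X \<Longrightarrow> (\<Inter>n. V x n) = {x}"
    using shrinking_neighbourhood_system[OF reg gdelta] by metis
  \<comment> \<open>The cluster points of the sequence \<open>g\<close>.\<close>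
  define limits where "limits g = (\<Inter>n::nat. X closure_of (g ` {n..}))" for g
  define rest where "rest T = topspace X - (\<Union>(x, n)\<in>T. V x n)" for T
  \<comment> \<open>A cluster point is added only if it is unique. The second part adds one point
    outside each finite union of sets \<open>V x n\<close>, with \<open>x\<close> a term of
    \<open>g\<close>, that does not exhaust the space. Both parts are countable.\<close>
  define F where "F g = (if \<exists>x. limits g = {x} then limits g else {}) \<union>
      (\<lambda>T. SOME q. q \<in> rest T) ` {T \<in> Fpow (range g \<times> UNIV). rest T \<noteq> {}}" for g
  have F: "|F g| \<le>o ctwo ^c natLeq \<and> F g \<subseteq> topspace X" for g
  proof
    have "countable (Fpow (range g \<times> (UNIV :: nat set)))"
      unfolding Fpow_def by (subst conj_commute) (intro countable_Collect_finite_subset, simp)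
    then have "countable {T \<in> Fpow (range g \<times> UNIV). rest T \<noteq> {}}"
      by (rule countable_subset[rotated]) auto
    then show "|F g| \<le>o ctwo ^c natLeq"
      unfolding F_def by (intro countable_ordLeq_continuum countable_Un countable_image) auto
    have "limits g \<subseteq> topspace X"
      unfolding limits_def using closure_of_subset_topspace by fast
    moreover have "(SOME q. q \<in> rest T) \<in> topspace X" if "rest T \<noteq> {}" for T
      using some_in_eq[of "rest T"] that by (auto simp: rest_def)
    ultimately show "F g \<subseteq> topspace X"
      unfolding F_def by auto
  qed
  obtain M where M: "{x0} \<subseteq> M" "M \<subseteq> topspace X" "|M| \<le>o ctwo ^c natLeq"
    "\<And>g. range g \<subseteq> M \<Longrightarrow> F g \<subseteq> M"
    using closing_off[of "{x0}" "topspace X" F] F x0 by (auto simp: countable_ordLeq_continuum)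
  have "X closure_of M \<subseteq> M"
  proof
    fix x assume x: "x \<in> X closure_of M"
    then have xX: "x \<in> topspace X"
      using closure_of_subset_topspace by fast
    have "\<exists>y. y \<in> M \<inter> V x n" for n
      using x V(1)[OF xX, of n] V(3)[OF xX] unfolding in_closure_of by blast
    then obtain g where g: "\<And>n. g n \<in> M \<inter> V x n"
      by metis
    have "V x (Suc n) \<subseteq> V x n" for n
      using V(2)[OF xX, of n] closure_of_subset[OF openin_subset[OF V(1)[OF xX, of "Suc n"]]]
      by blast
    then have dec: "V x m \<subseteq> V x n" if "n \<le> m" for m n
      using that lift_Suc_antimono_le by blast
    \<comment> \<open>The shift by one matters: the tail from \<open>Suc n\<close> lies in
      \<open>V x (Suc n)\<close>, and the closure of that set is still inside
      \<open>V x n\<close>.\<close>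
    have "limits g \<subseteq> V x n" for n
    proof -
      have "g ` {Suc n..} \<subseteq> V x (Suc n)"
        using g dec by blast
      then have "X closure_of g ` {Suc n..} \<subseteq> V x n"
        using closure_of_mono V(2)[OF xX, of n] subset_trans by metis
      then show ?thesis
        unfolding limits_def by (rule INF_lower2[OF UNIV_I])
    qed
    then have "limits g \<subseteq> {x}"
      using V(3)[OF xX] by blast
    \<comment> \<open>Nested nonempty closed sets in a compact space have a common point.\<close>
    moreover have "limits g \<noteq> {}"
      unfolding limits_def
    proof (rule compact_space_imp_nest[OF compact closedin_closure_of])
      show "X closure_of g ` {n..} \<noteq> {}" for n
        using g M(2) by (auto simp: closure_of_eq_empty_gen disjnt_iff)
      show "decseq (\<lambda>n. X closure_of g ` {n..})"
        by (intro decseq_SucI closure_of_mono) auto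
    qed
    ultimately have "limits g = {x}"
      by blast
    then have "x \<in> F g"
      by (simp add: F_def)
    then show "x \<in> M"
      using M(4)[of g] g by blast
  qed
  then have compM: "compactin X M"
    using closedin_compact_space[OF compact] closure_of_subset_eq M(2) by blast
  have "topspace X \<subseteq> M"
  proof (rule ccontr)
    assume "\<not> topspace X \<subseteq> M"
    then obtain p where p: "p \<in> topspace X" "p \<notin> M"
      by blast
    obtain T where T: "T \<in> Fpow (M \<times> UNIV)" "M \<subseteq> (\<Union>(x, n)\<in>T. V x n)"
      "p \<notin> (\<Union>(x, n)\<in>T. V x n)"
      using compactin_neighbourhood_avoiding[OF compM p(2) V(1,3)] .
    \<comment> \<open>The centres occurring in \<open>T\<close> are turned into a sequence;
      including \<open>x0\<close> makes the enumerated set visibly nonempty, so that the range is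
      exactly this set.\<close>
    define g where "g = from_nat_into (insert x0 (fst ` T))"
    have "range g = insert x0 (fst ` T)"
      unfolding g_def using T(1) by (simp add: countable_finite Fpow_def)
    then have g: "range g \<subseteq> M" "T \<in> Fpow (range g \<times> UNIV)"
      using M(1) T(1) by (force simp: Fpow_def)+
    have p_rest: "p \<in> rest T"
      using p(1) T(3) by (simp add: rest_def)
    \<comment> \<open>The point selected for \<open>T\<close> is put into \<open>M\<close> by the
      closing off, yet it lies outside a cover of \<open>M\<close>.\<close>
    then have "(SOME q. q \<in> rest T) \<in> F g"
      using g(2) unfolding F_def by blast
    then have "(SOME q. q \<in> rest T) \<in> M"
      using M(4)[OF g(1)] by blast
    moreover have "(SOME q. q \<in> rest T) \<in> rest T"
      using p_rest by (rule someI)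
    ultimately show False
      using T(2) by (auto simp: rest_def)
  qed
  then show ?thesis
    using M(3) by (rule card_of_subset_continuum)
qed


section \<open>Kernels: points that lie in the closure of every answer\<close>

text \<open>Here \<open>\<phi>\<close> plays the role of Bob's answer after a fixed history. Given
  open sets \<open>\<U>\<close> covering the kernel, \<open>\<phi>\<close> is applied to the cover
  by all open sets whose closure either misses the kernel or fits into a member of
  \<open>\<U>\<close>. The closures of the finitely many sets answered cover the kernel, and each
  one meeting it fits into a member of \<open>\<U>\<close>.\<close>

lemma compact_kernel:
  assumes reg: "regular_space X"
    and \<phi>: "\<And>\<C>. \<C> \<in> open_covers X \<Longrightarrow> finite (\<phi> \<C>) \<and> \<phi> \<C> \<subseteq> \<C>"
  shows "compactin X {x \<in> topspace X. \<forall>\<C>\<in>open_covers X. x \<in> X closure_of \<Union>(\<phi> \<C>)}"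
    (is "compactin X ?K")
proof -
  define K where "K = ?K"
  have "compactin X K"
    unfolding compactin_def
  proof (intro conjI allI impI)
    show "K \<subseteq> topspace X"
      by (auto simp: K_def)
    fix \<U> assume \<U>: "(\<forall>U\<in>\<U>. openin X U) \<and> K \<subseteq> \<Union>\<U>"
    have "K = topspace X \<inter> (\<Inter>\<C>\<in>open_covers X. X closure_of \<Union>(\<phi> \<C>))"
      by (auto simp: K_def)
    also have "closedin X \<dots>"
      by (cases "open_covers X = {}") (auto intro!: closedin_Int closedin_INT)
    finally have K: "closedin X K" .
    define \<C> where "\<C> = {W. openin X W \<and> (X closure_of W \<inter> K = {} \<or> (\<exists>U\<in>\<U>. X closure_of W \<subseteq> U))}"
    have "\<exists>W\<in>\<C>. x \<in> W" if x: "x \<in> topspace X" for x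
    proof -
      obtain N where N: "openin X N" "x \<in> N" "N \<inter> K = {} \<or> (\<exists>U\<in>\<U>. N \<subseteq> U)"
      proof (cases "x \<in> K")
        case True
        then show thesis
          using \<U> that by blast
      next
        case False
        then show thesis
          using that[of "topspace X - K"] K x by blast
      qed
      obtain W where W: "openin X W" "x \<in> W" "X closure_of W \<subseteq> N"
        using regular_space_shrink[OF reg N(1,2)] .
      then have "W \<in> \<C>"
        using N(3) unfolding \<C>_def by blast
      then show ?thesis
        using W(2) by blast
    qed
    moreover have "\<forall>W\<in>\<C>. openin X W"
      by (simp add: \<C>_def)
    ultimately have cover: "\<C> \<in> open_covers X"
      unfolding open_covers_def using openin_subset by fast
    define \<G> where "\<G> = {W \<in> \<phi> \<C>. X closure_of W \<inter> K \<noteq> {}}"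
    have "\<forall>W\<in>\<G>. \<exists>U\<in>\<U>. X closure_of W \<subseteq> U"
      using \<phi>[OF cover] unfolding \<G>_def \<C>_def by blast
    then obtain u where u: "\<And>W. W \<in> \<G> \<Longrightarrow> u W \<in> \<U> \<and> X closure_of W \<subseteq> u W"
      by metis
    have "K \<subseteq> \<Union>(u ` \<G>)"
    proof
      fix x assume x: "x \<in> K"
      then have "x \<in> X closure_of \<Union>(\<phi> \<C>)"
        using cover by (simp add: K_def)
      \<comment> \<open>Closure commutes with this union because the answer is finite.\<close>
      then obtain W where "W \<in> \<phi> \<C>" "x \<in> X closure_of W"
        using \<phi>[OF cover] by (auto simp: closure_of_Union)
      then show "x \<in> \<Union>(u ` \<G>)"
        using u x unfolding \<G>_def by blast
    qed
    moreover have "finite (u ` \<G>)" "u ` \<G> \<subseteq> \<U>"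
      using u \<phi>[OF cover] by (auto simp: \<G>_def)
    ultimately show "\<exists>\<F>. finite \<F> \<and> \<F> \<subseteq> \<U> \<and> K \<subseteq> \<Union>\<F>"
      by blast
  qed
  then show ?thesis
    by (simp add: K_def)
qed

text \<open>The kernel \<open>K\<close> for all covers is small, being compact with G_delta points.
  It is also the intersection of at most continuum many open sets \<open>N T\<close>. For each
  \<open>T\<close>, a small subcover yields at most continuum many covers that together exclude
  every point outside \<open>N T\<close>; collecting these over all \<open>T\<close> cuts the space
  down to a subset of \<open>K\<close>.\<close>

lemma small_kernel:
  assumes reg: "regular_space X"
    and gdelta: "\<And>x. x \<in> topspace X \<Longrightarrow> gdelta_in X {x}"
    and subcover: "\<And>\<C>. \<C> \<in> open_covers X \<Longrightarrow>
      \<exists>\<D>\<subseteq>\<C>. |\<D>| \<le>o ctwo ^c natLeq \<and> topspace X \<subseteq> \<Union>\<D>"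
    and \<phi>: "\<And>\<C>. \<C> \<in> open_covers X \<Longrightarrow> finite (\<phi> \<C>) \<and> \<phi> \<C> \<subseteq> \<C>"
  shows "\<exists>Q\<subseteq>open_covers X. |Q| \<le>o ctwo ^c natLeq \<and>
    |{x \<in> topspace X. \<forall>\<C>\<in>Q. x \<in> X closure_of \<Union>(\<phi> \<C>)}| \<le>o ctwo ^c natLeq"
proof -
  define H where "H \<C> = X closure_of \<Union>(\<phi> \<C>)" for \<C>
  define K where "K = {x \<in> topspace X. \<forall>\<C>\<in>open_covers X. x \<in> H \<C>}"
  have compK: "compactin X K"
    unfolding K_def H_def by (rule compact_kernel[OF reg \<phi>])
  have KX: "K \<subseteq> topspace X"
    by (auto simp: K_def)
  have cardK: "|K| \<le>o ctwo ^c natLeq"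
  proof -
    have "gdelta_in (subtopology X K) {x}" if "x \<in> K" for x
      using gdelta[of x] that KX unfolding gdelta_in_subtopology by (intro exI[of _ "{x}"]) blast
    moreover have "topspace (subtopology X K) = K"
      using KX by (rule topspace_subtopology_subset)
    ultimately show ?thesis
      using compact_gdelta_points_ordLeq_continuum[of "subtopology X K"]
        compK reg regular_space_subtopology by (auto simp: compactin_subspace)
  qed
  obtain V where V: "\<And>x n. x \<in> topspace X \<Longrightarrow> openin X (V x n)"
    "\<And>x. x \<in> topspace X \<Longrightarrow> (\<Inter>n::nat. V x n) = {x}"
    using shrinking_neighbourhood_system[OF reg gdelta] by metis
  define N where "N T = (\<Union>(x, n)\<in>T. V x n)" for T
  define \<T> where "\<T> = {T \<in> Fpow (K \<times> UNIV). K \<subseteq> N T}"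
  have card\<T>: "|\<T>| \<le>o ctwo ^c natLeq"
  proof -
    have "|Fpow (K \<times> (UNIV :: nat set))| \<le>o ctwo ^c natLeq"
      by (intro card_of_Fpow_continuum card_of_Times_continuum cardK countable_ordLeq_continuum) simp
    then show ?thesis
      unfolding \<T>_def by (rule card_of_subset_continuum[rotated]) blast
  qed
  have "\<exists>Q\<subseteq>open_covers X. |Q| \<le>o ctwo ^c natLeq \<and> (\<forall>x\<in>topspace X - N T. \<exists>\<C>\<in>Q. x \<notin> H \<C>)"
    if T: "T \<in> \<T>" for T
  proof -
    \<comment> \<open>This is a cover: \<open>N T\<close> contains \<open>K\<close>, and a point
      outside \<open>K\<close> is missed by some \<open>H \<C>\<close>.\<close>
    define \<W> where "\<W> = insert (N T) ((\<lambda>\<C>. topspace X - H \<C>) ` open_covers X)"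
    have "T \<subseteq> K \<times> UNIV"
      using T by (auto simp: \<T>_def Fpow_def)
    then have "openin X (N T)"
      unfolding N_def using V(1) KX by (intro openin_Union) auto
    moreover have "openin X (topspace X - H \<C>)" for \<C>
      unfolding H_def by (intro openin_diff openin_topspace closedin_closure_of)
    ultimately have "\<forall>U\<in>\<W>. openin X U"
      by (simp add: \<W>_def)
    moreover have "\<Union>\<W> = topspace X"
    proof
      show "\<Union>\<W> \<subseteq> topspace X"
        using calculation openin_subset by (intro Sup_least) blast
      have "K \<subseteq> N T"
        using T by (simp add: \<T>_def)
      then show "topspace X \<subseteq> \<Union>\<W>"
        by (auto simp: \<W>_def K_def)
    qed
    ultimately have "\<W> \<in> open_covers X"
      by (simp add: open_covers_def)
    then obtain \<D> where \<D>: "\<D> \<subseteq> \<W>" "|\<D>| \<le>o ctwo ^c natLeq" "topspace X \<subseteq> \<Union>\<D>"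
      using subcover[of \<W>] by auto
    \<comment> \<open>Every member of the subcover other than \<open>N T\<close> is traced back to a
      cover that produced it; these covers form the required family for \<open>T\<close>.\<close>
    have "\<exists>\<C>. \<C> \<in> open_covers X \<and> D = topspace X - H \<C>" if "D \<in> \<D> - {N T}" for D
      using \<D>(1) that by (auto simp: \<W>_def)
    then obtain q where q: "\<And>D. D \<in> \<D> - {N T} \<Longrightarrow> q D \<in> open_covers X \<and> D = topspace X - H (q D)"
      by metis
    have "|q ` (\<D> - {N T})| \<le>o ctwo ^c natLeq"
      by (intro card_of_image_continuum card_of_subset_continuum[OF Diff_subset \<D>(2)])
    moreover have "\<exists>\<C>\<in>q ` (\<D> - {N T}). x \<notin> H \<C>" if x: "x \<in> topspace X - N T" for x
    proof -
      obtain D where D: "D \<in> \<D> - {N T}" "x \<in> D"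
        using \<D>(3) x by blast
      moreover have "D = topspace X - H (q D)"
        using q[OF D(1)] by (rule conjunct2)
      ultimately have "x \<notin> H (q D)"
        by (metis DiffD2)
      then show ?thesis
        using D(1) by blast
    qed
    moreover have "q ` (\<D> - {N T}) \<subseteq> open_covers X"
      using q by (intro image_subsetI) simp
    ultimately show ?thesis
      by blast
  qed
  then obtain Q where Q: "\<And>T. T \<in> \<T> \<Longrightarrow> Q T \<subseteq> open_covers X"
    "\<And>T. T \<in> \<T> \<Longrightarrow> |Q T| \<le>o ctwo ^c natLeq"
    "\<And>T x. T \<in> \<T> \<Longrightarrow> x \<in> topspace X - N T \<Longrightarrow> \<exists>\<C>\<in>Q T. x \<notin> H \<C>"
    by metis
  have "{x \<in> topspace X. \<forall>\<C>\<in>\<Union>(Q ` \<T>). x \<in> H \<C>} \<subseteq> K"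
  proof (rule ccontr)
    assume "\<not> ?thesis"
    then obtain y where y: "y \<in> topspace X" "\<forall>\<C>\<in>\<Union>(Q ` \<T>). y \<in> H \<C>" "y \<notin> K"
      by blast
    obtain T where "T \<in> Fpow (K \<times> UNIV)" "K \<subseteq> N T" "y \<notin> N T"
      using compactin_neighbourhood_avoiding[OF compK y(3) V] unfolding N_def .
    then have "T \<in> \<T>" "y \<in> topspace X - N T"
      using y(1) by (auto simp: \<T>_def)
    then show False
      using Q(3) y(2) by blast
  qed
  then have "|{x \<in> topspace X. \<forall>\<C>\<in>\<Union>(Q ` \<T>). x \<in> H \<C>}| \<le>o ctwo ^c natLeq"
    using cardK by (rule card_of_subset_continuum)
  moreover have "|\<Union>(Q ` \<T>)| \<le>o ctwo ^c natLeq"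
    by (intro card_of_UNION_continuum card\<T> Q(2))
  ultimately show ?thesis
    using Q(1) unfolding H_def by (intro exI[of _ "\<Union>(Q ` \<T>)"]) blast
qed

section \<open>Strategies, histories and the main argument\<close>

text \<open>The history stops strictly before \<open>\<alpha>\<close> and the current move is
  appended by an update. With \<open>s\<close> held fixed, \<open>\<sigma>\<close> thus becomes a
  map on covers of the kind to which \<open>small_kernel\<close> applies.\<close>

lemma strategy_answer:
  assumes "bob_strategy X \<sigma>" and \<alpha>: "\<alpha> \<in> Field omega1"
    and s: "dom s = underS omega1 \<alpha>" "ran s \<subseteq> open_covers X" and "\<C> \<in> open_covers X"
  shows "finite (\<sigma> (s(\<alpha> \<mapsto> \<C>))) \<and> \<sigma> (s(\<alpha> \<mapsto> \<C>)) \<subseteq> \<C>"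
proof -
  have "dom (s(\<alpha> \<mapsto> \<C>)) = under omega1 \<alpha>"
    using under_omega1[OF \<alpha>] s(1) by simp
  moreover have "ran (s(\<alpha> \<mapsto> \<C>)) \<subseteq> open_covers X"
    using s assms(5) by (auto simp: ran_def)
  ultimately have "finite (\<sigma> (s(\<alpha> \<mapsto> \<C>))) \<and> \<sigma> (s(\<alpha> \<mapsto> \<C>)) \<subseteq> the ((s(\<alpha> \<mapsto> \<C>)) \<alpha>)"
    using assms(1) \<alpha> unfolding bob_strategy_def by blast
  then show ?thesis
    by simp
qed

text \<open>The strict initial segment is the part of a play already determined when a wellfounded
  recursion chooses the move at \<open>\<alpha>\<close>.\<close>

definition history :: "(nat set \<Rightarrow> 'b) \<Rightarrow> nat set \<Rightarrow> (nat set \<rightharpoonup> 'b)" where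
  "history \<C> \<alpha> = (\<lambda>\<beta>. Some (\<C> \<beta>)) |` underS omega1 \<alpha>"

lemma dom_history: "dom (history \<C> \<alpha>) = underS omega1 \<alpha>"
  and ran_history: "ran (history \<C> \<alpha>) = \<C> ` underS omega1 \<alpha>"
  by (auto simp: history_def ran_def restrict_map_def split: if_splits)

lemma history_cong:
  "(\<And>\<beta>. \<beta> \<in> underS omega1 \<alpha> \<Longrightarrow> \<C> \<beta> = \<D> \<beta>) \<Longrightarrow> history \<C> \<alpha> = history \<D> \<alpha>"
  by (auto simp: history_def restrict_map_def fun_eq_iff)

lemma history_upd:
  assumes "\<alpha> \<in> Field omega1"
  shows "(history \<C> \<alpha>)(\<alpha> \<mapsto> \<C> \<alpha>) = (\<lambda>\<beta>. Some (\<C> \<beta>)) |` under omega1 \<alpha>"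
  using under_omega1[OF assms] by (auto simp: history_def restrict_map_def fun_eq_iff)

lemma winning_strategy_covers:
  assumes \<sigma>: "bob_winning_strategy X \<sigma>"
    and \<C>: "\<And>\<alpha>. \<alpha> \<in> Field omega1 \<Longrightarrow> \<C> \<alpha> \<in> open_covers X"
  shows "(\<Union>\<alpha>\<in>Field omega1. \<Union>(\<sigma> ((history \<C> \<alpha>)(\<alpha> \<mapsto> \<C> \<alpha>)))) = topspace X"
    and "\<And>\<alpha>. \<alpha> \<in> Field omega1 \<Longrightarrow>
      finite (\<sigma> ((history \<C> \<alpha>)(\<alpha> \<mapsto> \<C> \<alpha>))) \<and> \<sigma> ((history \<C> \<alpha>)(\<alpha> \<mapsto> \<C> \<alpha>)) \<subseteq> \<C> \<alpha>"
proof -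
  define \<F> where "\<F> \<alpha> = \<sigma> ((history \<C> \<alpha>)(\<alpha> \<mapsto> \<C> \<alpha>))" for \<alpha>
  have \<F>: "finite (\<F> \<alpha>) \<and> \<F> \<alpha> \<subseteq> \<C> \<alpha>" if \<alpha>: "\<alpha> \<in> Field omega1" for \<alpha>
    unfolding \<F>_def
  proof (rule strategy_answer[OF _ \<alpha> dom_history])
    show "ran (history \<C> \<alpha>) \<subseteq> open_covers X"
      unfolding ran_history using \<C> by (auto simp: underS_def Field_def)
  qed (use \<sigma> \<C> \<alpha> in \<open>auto simp: bob_winning_strategy_def\<close>)
  then show "\<And>\<alpha>. \<alpha> \<in> Field omega1 \<Longrightarrow>
      finite (\<sigma> ((history \<C> \<alpha>)(\<alpha> \<mapsto> \<C> \<alpha>))) \<and> \<sigma> ((history \<C> \<alpha>)(\<alpha> \<mapsto> \<C> \<alpha>)) \<subseteq> \<C> \<alpha>"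
    unfolding \<F>_def .
  have "menger_play X \<C> \<F>"
    using \<F> \<C> by (simp add: menger_play_def)
  moreover have "\<forall>\<alpha>\<in>Field omega1. \<F> \<alpha> = \<sigma> ((\<lambda>\<beta>. Some (\<C> \<beta>)) |` under omega1 \<alpha>)"
    by (simp add: \<F>_def history_upd)
  ultimately have "bob_wins X \<F>"
    using \<sigma> unfolding bob_winning_strategy_def by blast
  then show "(\<Union>\<alpha>\<in>Field omega1. \<Union>(\<sigma> ((history \<C> \<alpha>)(\<alpha> \<mapsto> \<C> \<alpha>)))) = topspace X"
    unfolding bob_wins_def \<F>_def by blast
qed

text \<open>Alice plays \<open>\<C>\<close> in every inning; Bob then covers the space with finitely
  many members of \<open>\<C>\<close> in each of \<open>omega1\<close> innings, and
  \<open>omega1\<close> is at most the continuum.\<close>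

lemma winning_strategy_imp_small_subcover:
  assumes \<sigma>: "bob_winning_strategy X \<sigma>" and \<C>: "\<C> \<in> open_covers X"
  shows "\<exists>\<D>\<subseteq>\<C>. |\<D>| \<le>o ctwo ^c natLeq \<and> topspace X \<subseteq> \<Union>\<D>"
proof (intro exI conjI)
  let ?\<D> = "\<Union>\<alpha>\<in>Field omega1. \<sigma> ((history (\<lambda>_. \<C>) \<alpha>)(\<alpha> \<mapsto> \<C>))"
  note answers = winning_strategy_covers[OF \<sigma>, of "\<lambda>_. \<C>", OF \<C>]
  show "?\<D> \<subseteq> \<C>" "topspace X \<subseteq> \<Union>?\<D>"
    using answers by blast+
  show "|?\<D>| \<le>o ctwo ^c natLeq"
    using answers(2)
    by (intro card_of_UNION_continuum omega1_ordLeq_continuum countable_ordLeq_continuum countable_finite) blast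
qed

theorem theorem5:
  fixes X :: "'a topology"
  assumes "regular_space X" and "t1_space X"
    and "\<forall>x\<in>topspace X. gdelta_in X {x}"
    and "\<exists>\<sigma>. bob_winning_strategy X \<sigma>"
  shows "|topspace X| \<le>o ctwo ^c natLeq"
proof -
  obtain \<sigma> where \<sigma>: "bob_winning_strategy X \<sigma>"
    using assms(4) by blast
  have strategy: "bob_strategy X \<sigma>"
    using \<sigma> by (simp add: bob_winning_strategy_def)
  \<comment> \<open>The innings before \<open>\<alpha>\<close> are countable, so
    \<open>to_nat_on\<close> lets an ordinary sequence \<open>g\<close> code a history. This puts
    histories into the form that \<open>closing_off\<close> and the counting of sequences
    expect.\<close>
  define s where "s \<alpha> g = history (g \<circ> to_nat_on (underS omega1 \<alpha>)) \<alpha>"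
    for \<alpha> and g :: "nat \<Rightarrow> 'a set set"
  define P where "P Q \<alpha> g = {x \<in> topspace X. \<forall>\<C>\<in>Q. x \<in> X closure_of \<Union>(\<sigma> ((s \<alpha> g)(\<alpha> \<mapsto> \<C>)))}"
    for Q \<alpha> g
  have "\<exists>Q\<subseteq>open_covers X. |Q| \<le>o ctwo ^c natLeq \<and> |P Q \<alpha> g| \<le>o ctwo ^c natLeq"
    if "\<alpha> \<in> Field omega1" "range g \<subseteq> open_covers X" for \<alpha> g
    unfolding P_def
  proof (rule small_kernel)
    have "ran (s \<alpha> g) \<subseteq> open_covers X"
      using that(2) by (auto simp: s_def ran_history)
    then show "finite (\<sigma> ((s \<alpha> g)(\<alpha> \<mapsto> \<C>))) \<and> \<sigma> ((s \<alpha> g)(\<alpha> \<mapsto> \<C>)) \<subseteq> \<C>" if "\<C> \<in> open_covers X" for \<C>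
      using strategy_answer[OF strategy] \<open>\<alpha> \<in> Field omega1\<close> that by (simp add: s_def dom_history)
  qed (use assms winning_strategy_imp_small_subcover[OF \<sigma>] in auto)
  then obtain Q where Q: "\<And>\<alpha> g. \<alpha> \<in> Field omega1 \<Longrightarrow> range g \<subseteq> open_covers X \<Longrightarrow>
      Q \<alpha> g \<subseteq> open_covers X \<and> |Q \<alpha> g| \<le>o ctwo ^c natLeq \<and> |P (Q \<alpha> g) \<alpha> g| \<le>o ctwo ^c natLeq"
    by metis
  \<comment> \<open>The seed of the closing off; it also serves as a default value below.\<close>
  have trivial_cover: "{topspace X} \<in> open_covers X"
    by (simp add: open_covers_def)
  obtain M where M: "{{topspace X}} \<subseteq> M" "M \<subseteq> open_covers X" "|M| \<le>o ctwo ^c natLeq"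
    "\<And>g. range g \<subseteq> M \<Longrightarrow> (\<Union>\<alpha>\<in>Field omega1. Q \<alpha> g) \<subseteq> M"
  \<comment> \<open>One sequence codes a history for every inning, hence the union over all
    \<open>\<alpha>\<close>.\<close>
  proof (rule closing_off[of "{{topspace X}}" "open_covers X" "\<lambda>g. \<Union>\<alpha>\<in>Field omega1. Q \<alpha> g"])
    show "|{{topspace X}}| \<le>o ctwo ^c natLeq"
      by (simp add: countable_ordLeq_continuum)
    show "|\<Union>\<alpha>\<in>Field omega1. Q \<alpha> g| \<le>o ctwo ^c natLeq \<and> (\<Union>\<alpha>\<in>Field omega1. Q \<alpha> g) \<subseteq> open_covers X"
      if "range g \<subseteq> open_covers X" for g
      using Q that by (intro conjI card_of_UNION_continuum omega1_ordLeq_continuum) blast+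
  qed (use trivial_cover in auto)
  define G where "G = {g :: nat \<Rightarrow> 'a set set. range g \<subseteq> M}"
  have "topspace X \<subseteq> (\<Union>\<alpha>\<in>Field omega1. \<Union>g\<in>G. P (Q \<alpha> g) \<alpha> g)"
  proof (rule ccontr)
    assume "\<not> ?thesis"
    then obtain p where p: "p \<in> topspace X"
      "\<And>\<alpha> g. \<alpha> \<in> Field omega1 \<Longrightarrow> range g \<subseteq> M \<Longrightarrow> p \<notin> P (Q \<alpha> g) \<alpha> g"
      unfolding G_def by blast
    \<comment> \<open>The choice principle ranges over all indices, so the condition is made vacuous
      outside the field of \<open>omega1\<close>.\<close>
    define good where "good \<C> \<alpha> C \<longleftrightarrow> \<alpha> \<in> Field omega1 \<longrightarrow>
        C \<in> M \<and> p \<notin> \<Union>(\<sigma> ((history \<C> \<alpha>)(\<alpha> \<mapsto> C)))" for \<C> \<alpha> C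
    have "\<exists>\<C>. \<forall>\<alpha>. good \<C> \<alpha> (\<C> \<alpha>)"
    proof (rule dependent_wf_choice[OF wf_omega1])
      fix \<C> \<D> :: "nat set \<Rightarrow> 'a set set" and \<alpha> C
      assume "\<And>\<beta>. (\<beta>, \<alpha>) \<in> omega1 - Id \<Longrightarrow> \<C> \<beta> = \<D> \<beta>"
      then have "history \<C> \<alpha> = history \<D> \<alpha>"
        by (intro history_cong) (auto simp: underS_def)
      then show "good \<C> \<alpha> C = good \<D> \<alpha> C"
        by (simp add: good_def)
    next
      fix \<alpha> \<C> assume IH: "\<And>\<beta>. (\<beta>, \<alpha>) \<in> omega1 - Id \<Longrightarrow> good \<C> \<beta> (\<C> \<beta>)"
      show "\<exists>C. good \<C> \<alpha> C"
      proof (cases "\<alpha> \<in> Field omega1")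
        case \<alpha>: True
        have \<C>: "\<C> \<beta> \<in> M" if "\<beta> \<in> underS omega1 \<alpha>" for \<beta>
          using IH[of \<beta>] that by (auto simp: good_def underS_def Field_def)
        \<comment> \<open>A code for the history so far: \<open>from_nat_into\<close> inverts
          \<open>to_nat_on\<close>. The default occurs only if the initial segment is empty, that
          is, at the first inning.\<close>
        define g where "g n = (let \<beta> = from_nat_into (underS omega1 \<alpha>) n in
            if \<beta> \<in> underS omega1 \<alpha> then \<C> \<beta> else {topspace X})" for n
        have gM: "range g \<subseteq> M"
          using \<C> M(1) by (auto simp: g_def Let_def)
        have s: "s \<alpha> g = history \<C> \<alpha>"
          unfolding s_def using countable_underS_omega1[OF \<alpha>]
          by (intro history_cong) (simp add: g_def)
        \<comment> \<open>Since \<open>p\<close> avoids the set cut out for this history, some cover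
          in \<open>Q \<alpha> g\<close> has an answer whose closure misses \<open>p\<close>; the
          closing off puts that cover into \<open>M\<close>.\<close>
        obtain C where C: "C \<in> Q \<alpha> g" "p \<notin> X closure_of \<Union>(\<sigma> ((history \<C> \<alpha>)(\<alpha> \<mapsto> C)))"
          using p(2)[OF \<alpha> gM] p(1) unfolding P_def s by blast
        have CM: "C \<in> M"
          using M(4)[OF gM] C(1) \<alpha> by blast
        have "\<sigma> ((history \<C> \<alpha>)(\<alpha> \<mapsto> C)) \<subseteq> C"
          using strategy_answer[OF strategy \<alpha> dom_history, of \<C> C] \<C> CM M(2)
          by (auto simp: ran_history)
        then have "\<Union>(\<sigma> ((history \<C> \<alpha>)(\<alpha> \<mapsto> C))) \<subseteq> topspace X"
          using CM M(2) unfolding open_covers_def by blast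
        then have "p \<notin> \<Union>(\<sigma> ((history \<C> \<alpha>)(\<alpha> \<mapsto> C)))"
          using C(2) closure_of_subset by blast
        then show ?thesis
          using CM unfolding good_def by blast
      qed (simp add: good_def)
    qed
    then obtain \<C> where \<C>: "\<And>\<alpha>. \<alpha> \<in> Field omega1 \<Longrightarrow> \<C> \<alpha> \<in> M"
      "\<And>\<alpha>. \<alpha> \<in> Field omega1 \<Longrightarrow> p \<notin> \<Union>(\<sigma> ((history \<C> \<alpha>)(\<alpha> \<mapsto> \<C> \<alpha>)))"
      unfolding good_def by metis
    \<comment> \<open>The moves chosen form a legal play for Alice, so Bob's winning strategy must
      cover \<open>p\<close> in some inning.\<close>
    have "p \<in> (\<Union>\<alpha>\<in>Field omega1. \<Union>(\<sigma> ((history \<C> \<alpha>)(\<alpha> \<mapsto> \<C> \<alpha>))))"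
      using winning_strategy_covers(1)[OF \<sigma>, of \<C>] \<C>(1) M(2) p(1) by blast
    then show False
      using \<C>(2) by blast
  qed
  moreover have "|\<Union>\<alpha>\<in>Field omega1. \<Union>g\<in>G. P (Q \<alpha> g) \<alpha> g| \<le>o ctwo ^c natLeq"
    unfolding G_def using Q M(2)
    by (intro card_of_UNION_continuum omega1_ordLeq_continuum card_of_sequences_continuum M(3)) blast
  ultimately show ?thesis
    by (rule card_of_subset_continuum)
qed

end
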